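(* Let $G$ be a finite graph (undirected; multiple edges and loops allowed) with $n(G)$ vertices and $m(G)$ edges. Then for every integer $k\ge 2$, $$C(G,k)=\frac{(k-1)^{m(G)}}{k^{m(G)-n(G)}}\sum_{H\le G}\frac{F(H,k)}{(1-k)^{m(H)}},$$ where the sum runs over all edge subgraphs $H$ of $G$ (including the empty one).
   Context: Graphs are finite and undirected, and may have multiple edges and loops; $n(H)$ and $m(H)$ denote the number of vertices and edges of $H$. $H\le G$ means $H$ is an edge subgraph of $G$: $E(H)\subseteq E(G)$ and $V(H)$ consists exactly of the vertices of $G$ incident to edges of $E(H)$; the case $E(H)=V(H)=\emptyset$ is allowed, and distinct edge sets give distinct terms in the sum. $C(H,k)$ is the chromatic polynomial: the number of maps $s:V(H)\to\mathbb{Z}/k\mathbb{Z}$ such that the two ends of every edge receive different values (so $C(H,k)=0$ if $H$ has a loop). $F(H,k)$ is the flow polynomial: fix an orientation of every edge $e$, with tail $e'$ and head $e''$; $F(H,k)$ is the number of maps $t:E(H)\to\mathbb{Z}/k\mathbb{Z}$ with $t(e)\neq 0$ for all $e$ and $\sum_{e:\,e'=v}t(e)=\sum_{e:\,e''=v}t(e)$ in $\mathbb{Z}/k\mathbb{Z}$ for every vertex $v$ (a loop at $v$ contributes to both sides); this number does not depend on the chosen orientation. For the empty graph, $F=1$. *)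

theory Defs
  imports Complex_Main "HOL-Library.FuncSet" "HOL-Library.Uprod" "HOL-Number_Theory.Cong"
begin

text \<open>
  Undirected multigraphs: the two ends of an edge form an unordered pair, and a loop at
  \<open>v\<close> has ends \<open>Upair v v\<close>.
\<close>

record ('v, 'e) ugraph =
  verts :: "'v set"
  edges :: "'e set"
  ends :: "'e \<Rightarrow> 'v uprod"

definition finite_ugraph :: "('v, 'e) ugraph \<Rightarrow> bool" where
  "finite_ugraph G \<longleftrightarrow> finite (verts G) \<and> finite (edges G) \<and>
     (\<forall>e\<in>edges G. set_uprod (ends G e) \<subseteq> verts G)"

abbreviation num_verts :: "('v, 'e) ugraph \<Rightarrow> nat" where
  "num_verts G \<equiv> card (verts G)"

abbreviation num_edges :: "('v, 'e) ugraph \<Rightarrow> nat" where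
  "num_edges G \<equiv> card (edges G)"

text \<open>
  Since \<^const>\<open>ends\<close> is a total function, it is required to agree everywhere, so that a
  subgraph is determined by its edge set (lemma \<open>bij_betw_edge_subgraphs\<close>).
\<close>

definition edge_subgraph :: "('v, 'e) ugraph \<Rightarrow> ('v, 'e) ugraph \<Rightarrow> bool" where
  "edge_subgraph H G \<longleftrightarrow> edges H \<subseteq> edges G \<and> ends H = ends G \<and>
     verts H = (\<Union>e\<in>edges H. set_uprod (ends H e))"

lemma bij_betw_edge_subgraphs:
  "bij_betw edges {H. edge_subgraph H G} (Pow (edges G))"
proof (rule bij_betwI[where g = "\<lambda>A. \<lparr>verts = (\<Union>e\<in>A. set_uprod (ends G e)), edges = A, ends = ends G\<rparr>"])
qed (auto simp: edge_subgraph_def)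

lemma finite_ugraph_edge_subgraph:
  "finite_ugraph G \<Longrightarrow> edge_subgraph H G \<Longrightarrow> finite_ugraph H"
  by (auto simp: finite_ugraph_def edge_subgraph_def intro: finite_subset)

text \<open>\<open>\<int>/k\<int>\<close> is represented by the residues \<open>{0..<k}\<close>, with equations read modulo \<open>k\<close>.\<close>

definition proper_colourings :: "('v, 'e) ugraph \<Rightarrow> int \<Rightarrow> ('v \<Rightarrow> int) set" where
  "proper_colourings G k = {s \<in> verts G \<rightarrow>\<^sub>E {0..<k}.
     \<forall>e\<in>edges G. \<forall>u v. ends G e = Upair u v \<longrightarrow> s u \<noteq> s v}"

definition chromatic_poly :: "('v, 'e) ugraph \<Rightarrow> int \<Rightarrow> nat" where
  "chromatic_poly G k = card (proper_colourings G k)"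

text \<open>An orientation assigns to every edge the pair of its tail and its head.\<close>

definition orientation :: "('v, 'e) ugraph \<Rightarrow> ('e \<Rightarrow> 'v \<times> 'v) \<Rightarrow> bool" where
  "orientation G \<omega> \<longleftrightarrow> (\<forall>e\<in>edges G. ends G e = Upair (fst (\<omega> e)) (snd (\<omega> e)))"

definition nowhere_zero_flows :: "('v, 'e) ugraph \<Rightarrow> ('e \<Rightarrow> 'v \<times> 'v) \<Rightarrow> int \<Rightarrow> ('e \<Rightarrow> int) set" where
  "nowhere_zero_flows G \<omega> k = {t \<in> edges G \<rightarrow>\<^sub>E {0..<k}.
     (\<forall>e\<in>edges G. t e \<noteq> 0) \<and>
     (\<forall>v\<in>verts G. [(\<Sum>e | e \<in> edges G \<and> fst (\<omega> e) = v. t e) =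
                    (\<Sum>e | e \<in> edges G \<and> snd (\<omega> e) = v. t e)] (mod k))}"

text \<open>
  The orientation chosen here is irrelevant, see lemma \<open>flow_poly_orientation\<close>.
\<close>

definition flow_poly :: "('v, 'e) ugraph \<Rightarrow> int \<Rightarrow> nat" where
  "flow_poly G k = card (nowhere_zero_flows G (SOME \<omega>. orientation G \<omega>) k)"

lemma ex_orientation: "\<exists>\<omega>. orientation G \<omega>"
proof -
  have "\<forall>e. \<exists>p. ends G e = Upair (fst p) (snd p)"
  proof
    fix e
    show "\<exists>p. ends G e = Upair (fst p) (snd p)"
      by (cases "ends G e") (metis fst_conv snd_conv)
  qed
  then show ?thesis
    unfolding orientation_def by metis
qed

lemma flow_reorient:
  fixes G :: "('v, 'e) ugraph"
  assumes fin: "finite (edges G)" and o1: "orientation G \<omega>" and o2: "orientation G \<omega>'"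
    and t: "t \<in> nowhere_zero_flows G \<omega> k"
  shows "(\<lambda>e\<in>edges G. if \<omega> e = \<omega>' e then t e else k - t e) \<in> nowhere_zero_flows G \<omega>' k"
    (is "?t' \<in> _")
proof -
  have tE: "0 < t e" "t e < k" if "e \<in> edges G" for e
    using t that by (force simp: nowhere_zero_flows_def PiE_iff)+
  have swap: "\<omega>' e = (snd (\<omega> e), fst (\<omega> e))" if "e \<in> edges G" "\<omega> e \<noteq> \<omega>' e" for e
    using o1 o2 that by (auto simp: orientation_def prod_eq_iff)
  have diff: "(\<Sum>e | e \<in> edges G \<and> fst (w e) = v. s e) - (\<Sum>e | e \<in> edges G \<and> snd (w e) = v. s e)
      = (\<Sum>e\<in>edges G. (if fst (w e) = v then s e else 0) - (if snd (w e) = v then s e else 0))"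
    for w :: "'e \<Rightarrow> 'v \<times> 'v" and s :: "'e \<Rightarrow> int" and v
    using fin by (simp add: sum_subtractf sum.inter_filter)
  have "[(\<Sum>e | e \<in> edges G \<and> fst (\<omega>' e) = v. ?t' e) =
         (\<Sum>e | e \<in> edges G \<and> snd (\<omega>' e) = v. ?t' e)] (mod k)" if v: "v \<in> verts G" for v
  proof -
    have "k dvd (\<Sum>e | e \<in> edges G \<and> fst (\<omega> e) = v. t e) - (\<Sum>e | e \<in> edges G \<and> snd (\<omega> e) = v. t e)"
      using t v by (auto simp: nowhere_zero_flows_def cong_iff_dvd_diff)
    then have 1: "k dvd (\<Sum>e\<in>edges G. (if fst (\<omega> e) = v then t e else 0) - (if snd (\<omega> e) = v then t e else 0))"
      by (simp only: diff)
    have "k dvd (\<Sum>e\<in>edges G.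
        ((if fst (\<omega>' e) = v then ?t' e else 0) - (if snd (\<omega>' e) = v then ?t' e else 0)) -
        ((if fst (\<omega> e) = v then t e else 0) - (if snd (\<omega> e) = v then t e else 0)))"
    proof (rule dvd_sum)
      fix e assume e: "e \<in> edges G"
      show "k dvd ((if fst (\<omega>' e) = v then ?t' e else 0) - (if snd (\<omega>' e) = v then ?t' e else 0)) -
        ((if fst (\<omega> e) = v then t e else 0) - (if snd (\<omega> e) = v then t e else 0))"
        using e swap[of e] by (cases "\<omega> e = \<omega>' e") auto
    qed
    then have "k dvd (\<Sum>e\<in>edges G. (if fst (\<omega>' e) = v then ?t' e else 0) - (if snd (\<omega>' e) = v then ?t' e else 0)) -
        (\<Sum>e\<in>edges G. (if fst (\<omega> e) = v then t e else 0) - (if snd (\<omega> e) = v then t e else 0))"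
      by (simp only: sum_subtractf)
    from dvd_add[OF this 1]
    have "k dvd (\<Sum>e\<in>edges G. (if fst (\<omega>' e) = v then ?t' e else 0) - (if snd (\<omega>' e) = v then ?t' e else 0))"
      by (simp only: diff_add_cancel)
    then show ?thesis
      by (simp only: cong_iff_dvd_diff diff)
  qed
  moreover have "0 < ?t' e \<and> ?t' e < k" if "e \<in> edges G" for e
    using tE[OF that] that by auto
  then have "?t' \<in> edges G \<rightarrow>\<^sub>E {0..<k}" "\<forall>e\<in>edges G. ?t' e \<noteq> 0"
    unfolding PiE_iff by (auto simp del: restrict_apply simp: less_imp_le) (metis less_irrefl)
  ultimately show ?thesis
    by (simp add: nowhere_zero_flows_def)
qed

lemma flow_poly_orientation:
  fixes G :: "('v, 'e) ugraph"
  assumes "finite_ugraph G" and o1: "orientation G \<omega>"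
  shows "flow_poly G k = card (nowhere_zero_flows G \<omega> k)"
proof -
  let ?\<omega> = "SOME \<omega>. orientation G \<omega>"
  have o2: "orientation G ?\<omega>"
    using ex_orientation by (rule someI_ex)
  have fin: "finite (edges G)"
    using assms by (simp add: finite_ugraph_def)
  have inv: "(\<lambda>e\<in>edges G. if w' e = w e then (\<lambda>e\<in>edges G. if w e = w' e then t e else k - t e) e
      else k - (\<lambda>e\<in>edges G. if w e = w' e then t e else k - t e) e) = t"
    if "t \<in> nowhere_zero_flows G w k" for w w' :: "'e \<Rightarrow> 'v \<times> 'v" and t
    using that by (auto simp: nowhere_zero_flows_def PiE_iff extensional_def fun_eq_iff)
  have "bij_betw (\<lambda>t. \<lambda>e\<in>edges G. if ?\<omega> e = \<omega> e then t e else k - t e)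
      (nowhere_zero_flows G ?\<omega> k) (nowhere_zero_flows G \<omega> k)"
    by (rule bij_betwI[where g = "\<lambda>t. \<lambda>e\<in>edges G. if \<omega> e = ?\<omega> e then t e else k - t e"])
      (use flow_reorient[OF fin o2 o1] flow_reorient[OF fin o1 o2] inv in \<open>blast+\<close>)
  then show ?thesis
    unfolding flow_poly_def by (rule bij_betw_same_card)
qed

end

theory Submission
  imports Defs
begin

text \<open>
  Fourier analysis on \<open>\<int>/k\<close>. Weight the value \<open>0\<close> by \<open>1\<close> and every other value by \<open>1/(1-k)\<close>,
  so that the sum over subgraphs becomes the weighted count of all \<open>\<int>/k\<close>-flows on \<open>G\<close>, sorted by
  support. Detecting conservation at each vertex by an average of characters, with frequency \<open>s v\<close>
  at \<open>v\<close>, and exchanging the sums leaves a sum over all maps \<open>s\<close> of a product over the edges. The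
  factor of an edge is the Fourier transform of the weight at the difference of \<open>s\<close> along that
  edge; it vanishes if the difference is \<open>0\<close> and equals \<open>k/(k-1)\<close> otherwise, so only proper
  colourings survive.
\<close>

text \<open>The argument ranges over all integers, so that products and differences of residues can
  be inserted without reducing them modulo \<open>k\<close>.\<close>

definition residue_char :: "int \<Rightarrow> int \<Rightarrow> complex" where
  "residue_char k a = cis (2 * pi * real_of_int a / real_of_int k)"

lemma residue_char_0 [simp]: "residue_char k 0 = 1"
  by (simp add: residue_char_def)

lemma residue_char_sum: "residue_char k (\<Sum>x\<in>A. f x) = (\<Prod>x\<in>A. residue_char k (f x))"
proof (induction A rule: infinite_finite_induct)
  case (insert x A)
  have "residue_char k (a + b) = residue_char k a * residue_char k b" for a b
    by (simp add: residue_char_def cis_mult add_divide_distrib distrib_left)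
  with insert show ?case by simp
qed auto

lemma residue_char_eq_1_iff:
  assumes "k > 0"
  shows "residue_char k a = 1 \<longleftrightarrow> k dvd a"
proof
  assume "residue_char k a = 1"
  then have "cos (2 * pi * real_of_int a / real_of_int k) = 1"
    by (simp add: residue_char_def complex_eq_iff)
  then obtain n :: int where "2 * pi * real_of_int a / real_of_int k = real_of_int n * 2 * pi"
    by (auto simp: cos_one_2pi_int)
  then have "real_of_int a = real_of_int (k * n)"
    using assms by (simp add: field_simps)
  then show "k dvd a"
    by (metis dvd_triv_left of_int_eq_iff)
next
  assume "k dvd a"
  then obtain n where "a = k * n" ..
  then have "2 * pi * real_of_int a / real_of_int k = 2 * pi * real_of_int n"
    using assms by simp
  then show "residue_char k a = 1"
    by (simp add: residue_char_def cis_multiple_2pi)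
qed

text \<open>Orthogonality of characters: the sum is geometric with ratio
  \<open>residue_char k d\<close>, a \<open>k\<close>-th root of unity, so it vanishes unless that
  ratio is 1.\<close>

lemma sum_residue_char:
  assumes "k > 0"
  shows "(\<Sum>a\<in>{0..<k}. residue_char k (a * d)) = (if k dvd d then of_int k else 0)"
proof -
  let ?z = "residue_char k d"
  have pow: "residue_char k (int n * d) = ?z ^ n" for n
    by (simp add: residue_char_def DeMoivre mult_ac)
  have "{0..<k} = int ` {..<nat k}"
    using assms by (simp add: image_int_atLeastLessThan lessThan_atLeast0)
  then have "(\<Sum>a\<in>{0..<k}. residue_char k (a * d)) = (\<Sum>n<nat k. ?z ^ n)"
    by (simp add: sum.reindex pow)
  moreover have "?z ^ nat k = 1"
    using assms by (simp add: pow[symmetric] residue_char_eq_1_iff)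
  ultimately show ?thesis
    using assms by (simp add: sum_gp_strict residue_char_eq_1_iff[OF assms, symmetric])
qed

text \<open>With \<open>c = 1 / (1 - k)\<close>, the weight is the constant \<open>c\<close> plus a
  spike of height \<open>1 - c\<close> at 0. The spike always contributes \<open>1 - c\<close>,
  which is \<open>k / (k - 1)\<close>; the constant contributes \<open>c * k\<close> when
  \<open>k\<close> divides \<open>d\<close> and 0 otherwise. This \<open>c\<close> is the solution
  of \<open>c * k + 1 - c = 0\<close>.\<close>

lemma fourier_edge_weight:
  assumes "k \<ge> 2"
  shows "(\<Sum>a\<in>{0..<k}. (if a = 0 then 1 else 1 / (1 - of_int k)) * residue_char k (a * d)) =
    (if k dvd d then 0 else of_int k / (of_int k - 1))"
proof -
  define c :: complex where "c = 1 / (1 - of_int k)"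
  have k: "(of_int k :: complex) \<noteq> 1" "k > 0"
    using assms by auto
  have "(\<Sum>a\<in>{0..<k}. (if a = 0 then 1 else c) * residue_char k (a * d)) =
      (\<Sum>a\<in>{0..<k}. c * residue_char k (a * d) + (if a = 0 then 1 - c else 0))"
    by (intro sum.cong) auto
  also have "\<dots> = c * (\<Sum>a\<in>{0..<k}. residue_char k (a * d)) + (1 - c)"
    using k by (simp add: sum.distrib sum_distrib_left)
  also have "\<dots> = (if k dvd d then 0 else of_int k / (of_int k - 1))"
  proof -
    \<comment> \<open>Writing \<open>k\<close> as \<open>1 + y\<close> turns both denominators
      \<open>1 - k\<close> and \<open>k - 1\<close> into multiples of the single nonzero quantity
      \<open>y\<close>.\<close>
    define y :: complex where "y = of_int k - 1"
    have "y \<noteq> 0" "of_int k = 1 + y"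
      using k by (auto simp: y_def)
    with k show ?thesis
      by (simp add: sum_residue_char c_def field_simps)
  qed
  finally show ?thesis
    by (simp only: c_def)
qed

text \<open>Net outflow as one signed sum over the edges, a form in which sums over vertices and
  edges can be exchanged; a loop cancels itself.\<close>

definition excess :: "('e \<Rightarrow> 'v \<times> 'v) \<Rightarrow> 'e set \<Rightarrow> ('e \<Rightarrow> int) \<Rightarrow> 'v \<Rightarrow> int" where
  "excess \<omega> A t v = (\<Sum>e\<in>A. (if fst (\<omega> e) = v then t e else 0) - (if snd (\<omega> e) = v then t e else 0))"

lemma conservation_iff_excess:
  assumes "finite A"
  shows "[(\<Sum>e | e \<in> A \<and> fst (\<omega> e) = v. t e) = (\<Sum>e | e \<in> A \<and> snd (\<omega> e) = v. t e)] (mod k) \<longleftrightarrow>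
    k dvd excess \<omega> A t v"
  using assms by (simp add: excess_def cong_iff_dvd_diff sum_subtractf sum.inter_filter)

text \<open>Edges with value 0 add nothing at either end. This allows restricting a flow to its
  support and extending it back by zero.\<close>

lemma excess_restrict:
  assumes "finite E" "A \<subseteq> E" "\<And>e. e \<in> E - A \<Longrightarrow> t e = 0" "\<And>e. e \<in> A \<Longrightarrow> t' e = t e"
  shows "excess \<omega> E t v = excess \<omega> A t' v"
  unfolding excess_def using assms by (intro sum.mono_neutral_cong_right) auto

text \<open>Summation by parts: after exchanging the sums, an edge meets \<open>s\<close> only at
  its tail, with sign plus, and at its head, with sign minus. Sums over vertices thereby become sums
  over edges.\<close>

lemma sum_mult_excess:
  assumes "finite V" "\<And>e. e \<in> A \<Longrightarrow> fst (\<omega> e) \<in> V \<and> snd (\<omega> e) \<in> V"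
  shows "(\<Sum>v\<in>V. s v * excess \<omega> A t v) = (\<Sum>e\<in>A. t e * (s (fst (\<omega> e)) - s (snd (\<omega> e))))"
proof -
  have "(\<Sum>v\<in>V. s v * excess \<omega> A t v) =
      (\<Sum>e\<in>A. \<Sum>v\<in>V. (if fst (\<omega> e) = v then s v * t e else 0) - (if snd (\<omega> e) = v then s v * t e else 0))"
    unfolding excess_def sum_distrib_left
    by (subst sum.swap) (auto intro!: sum.cong simp: algebra_simps)
  also have "\<dots> = (\<Sum>e\<in>A. t e * (s (fst (\<omega> e)) - s (snd (\<omega> e))))"
    using assms by (intro sum.cong) (auto simp: sum_subtractf algebra_simps)
  finally show ?thesis .
qed

text \<open>The value 0 is allowed here, so the nowhere-zero flows of all edge subgraphs appear
  together, each as a flow with prescribed support.\<close>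

definition zk_flows :: "('v, 'e) ugraph \<Rightarrow> ('e \<Rightarrow> 'v \<times> 'v) \<Rightarrow> int \<Rightarrow> ('e \<Rightarrow> int) set" where
  "zk_flows G \<omega> k = {t \<in> edges G \<rightarrow>\<^sub>E {0..<k}. \<forall>v\<in>verts G. k dvd excess \<omega> (edges G) t v}"

lemma orientation_ends:
  assumes "finite_ugraph G" "orientation G \<omega>" "e \<in> edges G"
  shows "fst (\<omega> e) \<in> verts G" "snd (\<omega> e) \<in> verts G"
  using assms by (force simp: finite_ugraph_def orientation_def)+

text \<open>Restriction to \<open>edges H\<close> and extension by zero are mutually inverse
  bijections between the two kinds of flow.\<close>

lemma card_zk_flows_support:
  assumes G: "finite_ugraph G" and \<omega>: "orientation G \<omega>" and H: "edge_subgraph H G" and k: "k > 0"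
  shows "card {t \<in> zk_flows G \<omega> k. {e \<in> edges G. t e \<noteq> 0} = edges H} = flow_poly H k"
proof -
  let ?S = "{t \<in> zk_flows G \<omega> k. {e \<in> edges G. t e \<noteq> 0} = edges H}"
  have sub: "edges H \<subseteq> edges G" and ends: "ends H = ends G"
    and vH: "verts H = (\<Union>e\<in>edges H. set_uprod (ends H e))"
    using H by (auto simp: edge_subgraph_def)
  have fin: "finite (edges G)" "finite (edges H)"
    using G sub finite_subset by (auto simp: finite_ugraph_def)
  have \<omega>H: "orientation H \<omega>"
    using \<omega> sub by (auto simp: orientation_def ends)
  have H': "finite_ugraph H"
    using G H by (rule finite_ugraph_edge_subgraph)
  have vHG: "verts H \<subseteq> verts G"
    using G sub by (auto simp: vH ends finite_ugraph_def)
  \<comment> \<open>\<open>H\<close> imposes conservation only on its own vertices. At the other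
    vertices of \<open>G\<close> it holds trivially, since no edge of \<open>H\<close> ends
    there.\<close>
  have outside: "excess \<omega> (edges H) t v = 0" if "v \<notin> verts H" for t v
    unfolding excess_def using that orientation_ends[OF H' \<omega>H] by (intro sum.neutral) auto
  let ?f = "\<lambda>t. restrict t (edges H)"
  \<comment> \<open>Two defaults matter: 0 on the edges of \<open>G\<close> outside
    \<open>H\<close>, and \<open>undefined\<close> outside \<open>edges G\<close>, as extensionality
    demands.\<close>
  let ?g = "\<lambda>t. \<lambda>e\<in>edges G. if e \<in> edges H then t e else 0"
  have "bij_betw ?f ?S (nowhere_zero_flows H \<omega> k)"
  proof (rule bij_betwI[where g = ?g])
    show "?f \<in> ?S \<rightarrow> nowhere_zero_flows H \<omega> k"
    proof
      fix t assume t: "t \<in> ?S"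
      then have nz: "t e \<noteq> 0 \<longleftrightarrow> e \<in> edges H" if "e \<in> edges G" for e
        using that by auto
      have "excess \<omega> (edges G) t v = excess \<omega> (edges H) (?f t) v" for v
        using nz by (intro excess_restrict fin sub) auto
      then have "\<forall>v\<in>verts H. k dvd excess \<omega> (edges H) (?f t) v"
        using t vHG by (auto simp: zk_flows_def)
      moreover have "t e \<in> {0..<k} \<and> t e \<noteq> 0" if "e \<in> edges H" for e
        using t nz sub that by (simp add: zk_flows_def PiE_iff subset_eq)
      then have "?f t \<in> edges H \<rightarrow>\<^sub>E {0..<k}" "\<forall>e\<in>edges H. ?f t e \<noteq> 0"
        by auto
      ultimately show "?f t \<in> nowhere_zero_flows H \<omega> k"
        by (simp add: nowhere_zero_flows_def conservation_iff_excess fin del: restrict_apply)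
    qed
    show "?g \<in> nowhere_zero_flows H \<omega> k \<rightarrow> ?S"
    proof
      fix t assume t: "t \<in> nowhere_zero_flows H \<omega> k"
      have "excess \<omega> (edges G) (?g t) v = excess \<omega> (edges H) t v" for v
        using sub by (intro excess_restrict fin sub) auto
      then have "k dvd excess \<omega> (edges G) (?g t) v" for v
        using t fin outside[of v t]
        by (cases "v \<in> verts H") (auto simp: nowhere_zero_flows_def conservation_iff_excess)
      moreover have "t e \<in> {0..<k} \<and> t e \<noteq> 0" if "e \<in> edges H" for e
        using t that by (auto simp: nowhere_zero_flows_def PiE_iff)
      then have "?g t \<in> edges G \<rightarrow>\<^sub>E {0..<k}" "{e \<in> edges G. ?g t e \<noteq> 0} = edges H"
        using sub k by auto
      ultimately show "?g t \<in> ?S"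
        by (simp add: zk_flows_def del: restrict_apply)
    qed
    show "?g (?f t) = t" if "t \<in> ?S" for t
      using that by (auto simp: zk_flows_def PiE_iff extensional_def fun_eq_iff)
    show "?f (?g t) = t" if "t \<in> nowhere_zero_flows H \<omega> k" for t
      using that sub by (auto simp: nowhere_zero_flows_def PiE_iff extensional_def fun_eq_iff)
  qed
  then show ?thesis
    by (simp add: flow_poly_orientation[OF H' \<omega>H] bij_betw_same_card)
qed

text \<open>Group the flows by support: a flow with support \<open>A\<close> has weight
  \<open>c ^ card A\<close>, and the possible supports correspond to the edge subgraphs.\<close>

lemma sum_flow_poly_eq_sum_zk_flows:
  fixes c :: "'a :: field"
  assumes G: "finite_ugraph G" and \<omega>: "orientation G \<omega>" and k: "k > 0"
  shows "(\<Sum>H | edge_subgraph H G. of_nat (flow_poly H k) * c ^ num_edges H) =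
    (\<Sum>t\<in>zk_flows G \<omega> k. \<Prod>e\<in>edges G. if t e = 0 then 1 else c)"
proof -
  let ?supp = "\<lambda>t. {e \<in> edges G. t e \<noteq> 0}"
  let ?fib = "\<lambda>A. {t \<in> zk_flows G \<omega> k. ?supp t = A}"
  have fin: "finite (edges G)"
    using G by (simp add: finite_ugraph_def)
  have finZ: "finite (zk_flows G \<omega> k)"
    by (rule finite_subset[OF _ finite_PiE[OF fin, of "\<lambda>_. {0..<k}"]]) (auto simp: zk_flows_def)
  have weight: "(\<Prod>e\<in>edges G. if t e = 0 then 1 else c) = c ^ card (?supp t)" for t :: "'c \<Rightarrow> int"
    using fin by (simp add: prod.If_cases Int_def Compl_eq)
  have "(\<Sum>t\<in>zk_flows G \<omega> k. \<Prod>e\<in>edges G. if t e = 0 then 1 else c) =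
      (\<Sum>A\<in>Pow (edges G). \<Sum>t\<in>?fib A. \<Prod>e\<in>edges G. if t e = 0 then 1 else c)"
    by (rule sum.group[symmetric]) (use fin finZ in auto)
  also have "\<dots> = (\<Sum>A\<in>Pow (edges G). of_nat (card (?fib A)) * c ^ card A)"
    by (intro sum.cong) (simp_all add: weight)
  also have "\<dots> = (\<Sum>H | edge_subgraph H G. of_nat (card (?fib (edges H))) * c ^ num_edges H)"
    by (rule sum.reindex_bij_betw[OF bij_betw_edge_subgraphs, symmetric])
  also have "\<dots> = (\<Sum>H | edge_subgraph H G. of_nat (flow_poly H k) * c ^ num_edges H)"
    using card_zk_flows_support[OF G \<omega> _ k] by (intro sum.cong) auto
  finally show ?thesis by simp
qed

text \<open>A double sum over pairs of an edge labelling \<open>t\<close> and a vertex labelling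
  \<open>s\<close> is evaluated in both orders. The power of \<open>k\<close> on the left arises
  because the characters are summed, not averaged, at each vertex.\<close>

lemma sum_zk_flows:
  assumes G: "finite_ugraph G" and \<omega>: "orientation G \<omega>" and k: "k \<ge> 2"
  shows "of_int k ^ num_verts G *
      (\<Sum>t\<in>zk_flows G \<omega> k. \<Prod>e\<in>edges G. if t e = 0 then 1 else 1 / (1 - of_int k)) =
    of_nat (chromatic_poly G k) * (of_int k / (of_int k - 1) :: complex) ^ num_edges G"
proof -
  let ?V = "verts G" and ?E = "edges G"
  let ?R = "{0..<k}"
  define w :: "int \<Rightarrow> complex" where "w a = (if a = 0 then 1 else 1 / (1 - of_int k))" for a
  have fin: "finite ?V" "finite ?E"
    using G by (auto simp: finite_ugraph_def)
  have finP: "finite (?V \<rightarrow>\<^sub>E ?R)" "finite (?E \<rightarrow>\<^sub>E ?R)"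
    using fin by (auto intro: finite_PiE)
  let ?d = "\<lambda>s e. s (fst (\<omega> e)) - s (snd (\<omega> e))"
  \<comment> \<open>The inner sum for fixed \<open>t\<close>: regrouping by vertices makes the
    values of \<open>s\<close> independent, and orthogonality at each vertex tests conservation
    there.\<close>
  have detect: "(\<Sum>s\<in>?V \<rightarrow>\<^sub>E ?R. \<Prod>e\<in>?E. residue_char k (t e * ?d s e)) =
      (if t \<in> zk_flows G \<omega> k then of_int k ^ num_verts G else 0)" if "t \<in> ?E \<rightarrow>\<^sub>E ?R" for t
  proof -
    have "(\<Sum>s\<in>?V \<rightarrow>\<^sub>E ?R. \<Prod>e\<in>?E. residue_char k (t e * ?d s e)) =
        (\<Sum>s\<in>?V \<rightarrow>\<^sub>E ?R. \<Prod>v\<in>?V. residue_char k (s v * excess \<omega> ?E t v))"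
      using fin orientation_ends[OF G \<omega>]
      by (simp add: residue_char_sum[symmetric] sum_mult_excess)
    also have "\<dots> = (\<Prod>v\<in>?V. \<Sum>a\<in>?R. residue_char k (a * excess \<omega> ?E t v))"
      using fin by (simp add: prod_sum_PiE)
    also have "\<dots> = (\<Prod>v\<in>?V. if k dvd excess \<omega> ?E t v then of_int k else 0)"
      using k by (simp add: sum_residue_char)
    also have "\<dots> = (if t \<in> zk_flows G \<omega> k then of_int k ^ num_verts G else 0)"
      using that fin by (auto simp: zk_flows_def)
    finally show ?thesis .
  qed
  \<comment> \<open>The inner sum for fixed \<open>s\<close>, already factored over the edges: one
    monochromatic edge makes the product vanish.\<close>
  have edge: "(\<Prod>e\<in>?E. \<Sum>a\<in>?R. w a * residue_char k (a * ?d s e)) =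
      (if s \<in> proper_colourings G k then (of_int k / (of_int k - 1)) ^ num_edges G else 0)"
    if s: "s \<in> ?V \<rightarrow>\<^sub>E ?R" for s
  proof -
    \<comment> \<open>Both colours lie in \<open>{0..<k}\<close>, so congruence modulo
      \<open>k\<close> is equality.\<close>
    have eq: "k dvd ?d s e \<longleftrightarrow> s (fst (\<omega> e)) = s (snd (\<omega> e))" if "e \<in> ?E" for e
    proof -
      have "0 \<le> s (fst (\<omega> e))" "s (fst (\<omega> e)) < k" "0 \<le> s (snd (\<omega> e))" "s (snd (\<omega> e)) < k"
        using s orientation_ends[OF G \<omega> that] by (auto simp: PiE_iff)
      then show ?thesis
        by (metis mod_eq_dvd_iff mod_pos_pos_trivial)
    qed
    have proper: "s \<in> proper_colourings G k \<longleftrightarrow> (\<forall>e\<in>?E. s (fst (\<omega> e)) \<noteq> s (snd (\<omega> e)))"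
      using s \<omega> by (force simp: proper_colourings_def orientation_def)
    have "(\<Prod>e\<in>?E. \<Sum>a\<in>?R. w a * residue_char k (a * ?d s e)) =
        (\<Prod>e\<in>?E. if s (fst (\<omega> e)) = s (snd (\<omega> e)) then 0 else of_int k / (of_int k - 1))"
      unfolding w_def fourier_edge_weight[OF k] using eq by (intro prod.cong) auto
    then show ?thesis
      using fin by (auto simp: proper)
  qed
  have "of_int k ^ num_verts G * (\<Sum>t\<in>zk_flows G \<omega> k. \<Prod>e\<in>?E. w (t e)) =
      (\<Sum>t\<in>zk_flows G \<omega> k. (\<Prod>e\<in>?E. w (t e)) * of_int k ^ num_verts G)"
    by (simp add: sum_distrib_left mult.commute)
  also have "\<dots> = (\<Sum>t\<in>?E \<rightarrow>\<^sub>E ?R. (\<Prod>e\<in>?E. w (t e)) *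
      (if t \<in> zk_flows G \<omega> k then of_int k ^ num_verts G else 0))"
    using finP by (intro sum.mono_neutral_cong_left) (auto simp: zk_flows_def)
  also have "\<dots> = (\<Sum>t\<in>?E \<rightarrow>\<^sub>E ?R. \<Sum>s\<in>?V \<rightarrow>\<^sub>E ?R.
      \<Prod>e\<in>?E. w (t e) * residue_char k (t e * ?d s e))"
    by (intro sum.cong refl) (simp add: detect[symmetric] sum_distrib_left prod.distrib)
  \<comment> \<open>With \<open>s\<close> outermost, the distributive law turns the sum over all
    \<open>t\<close> of a product into a product over edges of independent sums.\<close>
  also have "\<dots> = (\<Sum>s\<in>?V \<rightarrow>\<^sub>E ?R. \<Prod>e\<in>?E. \<Sum>a\<in>?R. w a * residue_char k (a * ?d s e))"
    using fin by (subst sum.swap) (simp add: prod_sum_PiE)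
  also have "\<dots> = (\<Sum>s\<in>?V \<rightarrow>\<^sub>E ?R.
      if s \<in> proper_colourings G k then (of_int k / (of_int k - 1)) ^ num_edges G else 0)"
    by (intro sum.cong refl edge)
  also have "\<dots> = (\<Sum>s\<in>proper_colourings G k. (of_int k / (of_int k - 1)) ^ num_edges G)"
    using finP by (intro sum.mono_neutral_cong_right) (auto simp: proper_colourings_def)
  finally show ?thesis
    by (simp add: chromatic_poly_def w_def)
qed

theorem mainTheorem1:
  fixes G :: "('v, 'e) ugraph" and k :: int
  assumes "finite_ugraph G" and "k \<ge> 2"
  shows "real (chromatic_poly G k) =
    (real_of_int k - 1) ^ num_edges G / (real_of_int k powi (int (num_edges G) - int (num_verts G))) *
    (\<Sum>H | edge_subgraph H G. real (flow_poly H k) / (1 - real_of_int k) ^ num_edges H)"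
proof -
  let ?S = "\<Sum>H | edge_subgraph H G. real (flow_poly H k) / (1 - real_of_int k) ^ num_edges H"
  obtain \<omega> where \<omega>: "orientation G \<omega>"
    using ex_orientation by blast
  have "complex_of_real ?S =
      (\<Sum>H | edge_subgraph H G. of_nat (flow_poly H k) * (1 / (1 - of_int k)) ^ num_edges H)"
    by (simp add: power_divide)
  also have "\<dots> = (\<Sum>t\<in>zk_flows G \<omega> k. \<Prod>e\<in>edges G. if t e = 0 then 1 else 1 / (1 - of_int k))"
    using assms by (intro sum_flow_poly_eq_sum_zk_flows \<omega>) auto
  finally have "complex_of_real (real_of_int k ^ num_verts G * ?S) =
      complex_of_real (real (chromatic_poly G k) * (real_of_int k / (real_of_int k - 1)) ^ num_edges G)"
    using sum_zk_flows[OF assms(1) \<omega> assms(2)] by simp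
  \<comment> \<open>The characters forced complex values, but both sides are embedded reals, so the
    identity descends.\<close>
  then have "real_of_int k ^ num_verts G * ?S =
      real (chromatic_poly G k) * (real_of_int k / (real_of_int k - 1)) ^ num_edges G"
    by (simp only: of_real_eq_iff)
  moreover have "real_of_int k - 1 \<noteq> 0" "real_of_int k \<noteq> 0"
    using assms by auto
  \<comment> \<open>Solving for the chromatic polynomial; the exponent \<open>m - n\<close> may be
    negative, hence the integer power.\<close>
  ultimately show ?thesis
    by (simp add: power_int_diff power_divide field_simps)
qed

end
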